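(* Let $E$ and $F$ be finitely or countably generated Hilbert $A$-modules over a unital $C^*$-algebra $A$, let $X=\{x_n\}\subset E$ be a standard Bessel sequence with upper bound $D$, let $Y=\{y_n\}\subset F$ be an arbitrary sequence, and let $U\in L(\ell^2(A))$ be a non-zero adjointable operator. If the generalized multiplier $\mathbf{M}_{U,Y,X}:E\to F$ is an invertible operator, then $Y=\{y_n\}$ satisfies the lower frame condition, i.e. there is a constant $C>0$ such that $$C\langle y,y\rangle\le\sum_n\langle y,y_n\rangle\langle y_n,y\rangle\qquad\text{for every } y\in F.$$
   Context: Hilbert $A$-modules are left modules whose $A$-valued inner product is $A$-linear in the first argument. $L(E)$ denotes the set of adjointable operators on a Hilbert $A$-module $E$. $\ell^2(A)$ is the Hilbert $A$-module of sequences $\{a_n\}$ in $A$ such that $\sum_n a_na_n^*$ converges in norm, with $\langle\{a_n\},\{b_n\}\rangle=\sum_n a_nb_n^*$. A sequence $\{x_n\}\subset E$ is a frame if there are constants $C,D>0$ such that $C\langle x,x\rangle\le\sum_n\langle x,x_n\rangle\langle x_n,x\rangle\le D\langle x,x\rangle$ for every $x\in E$. It is a Bessel sequence with (upper) bound $D$ if the upper inequality holds for every $x\in E$, and it satisfies the lower frame condition if the lower inequality holds for every $x\in E$ with some $C>0$. The word "standard" means that, in addition, the sum converges in norm for every $x\in E$. The analysis operator of a standard Bessel sequence $X=\{x_n\}$ is the adjointable operator $T_X:E\to\ell^2(A)$, $T_Xx=\{\langle x,x_n\rangle\}_n$. The generalized multiplier with symbol $U$ is $\mathbf{M}_{U,Y,X}=T_Y^*UT_X$,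 where $T_Y^*(\{a_n\})=\sum_n a_ny_n$; that is, $\mathbf{M}_{U,Y,X}(x)=\sum_n (UT_Xx)_n\,y_n$, where $(UT_Xx)_n\in A$ is the $n$-th entry of $UT_Xx$ and, for an arbitrary sequence $Y$, the series is understood to converge in norm in $F$ for every $x\in E$. *)

theory Defs
  imports "HOL-Analysis.Analysis"
begin

section \<open>Unital C*-algebras\<close>

text \<open>
  The underlying real Banach algebra comes from the library classes; \<open>scaleC\<close> extends its real
  scalar multiplication. The library class forces \<open>norm 1 = 1\<close>, which excludes only the zero algebra.
\<close>

class unital_cstar_algebra = banach + real_normed_algebra_1 +
  fixes scaleC :: "complex \<Rightarrow> 'a \<Rightarrow> 'a" (infixr \<open>*\<^sub>C\<close> 75)
    and star :: "'a \<Rightarrow> 'a" (\<open>_\<^sup>\<star>\<close> [1000] 999)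
  assumes scaleC_of_real: "complex_of_real r *\<^sub>C a = r *\<^sub>R a"
    and scaleC_add_right: "c *\<^sub>C (a + b) = c *\<^sub>C a + c *\<^sub>C b"
    and scaleC_add_left: "(c + d) *\<^sub>C a = c *\<^sub>C a + d *\<^sub>C a"
    and scaleC_scaleC: "c *\<^sub>C (d *\<^sub>C a) = (c * d) *\<^sub>C a"
    and mult_scaleC_left: "(c *\<^sub>C a) * b = c *\<^sub>C (a * b)"
    and mult_scaleC_right: "a * (c *\<^sub>C b) = c *\<^sub>C (a * b)"
    and norm_scaleC: "norm (c *\<^sub>C a) = cmod c * norm a"
    and star_star: "(a\<^sup>\<star>)\<^sup>\<star> = a"
    and star_add: "(a + b)\<^sup>\<star> = a\<^sup>\<star> + b\<^sup>\<star>"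
    and star_scaleC: "(c *\<^sub>C a)\<^sup>\<star> = cnj c *\<^sub>C a\<^sup>\<star>"
    and star_mult: "(a * b)\<^sup>\<star> = b\<^sup>\<star> * a\<^sup>\<star>"
    and cstar_identity: "norm (a\<^sup>\<star> * a) = (norm a)\<^sup>2"

definition cstar_pos :: "'a::unital_cstar_algebra \<Rightarrow> bool"
  where "cstar_pos a \<longleftrightarrow> (\<exists>b. a = b\<^sup>\<star> * b)"

definition cstar_le :: "'a::unital_cstar_algebra \<Rightarrow> 'a \<Rightarrow> bool" (infix \<open>\<preceq>\<close> 50)
  where "a \<preceq> b \<longleftrightarrow> cstar_pos (b - a)"

definition positive_functional :: "('a::unital_cstar_algebra \<Rightarrow> complex) \<Rightarrow> bool"
  where "positive_functional \<phi> \<longleftrightarrow>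
    (\<forall>a b. \<phi> (a + b) = \<phi> a + \<phi> b) \<and> (\<forall>c a. \<phi> (c *\<^sub>C a) = c * \<phi> a) \<and>
    (\<forall>a. \<phi> (a\<^sup>\<star> * a) \<in> \<real>\<^sub>\<ge>\<^sub>0)"

text \<open>
  The relation \<open>a \<le> \<Sum>n. b n\<close> for positive \<open>a\<close> and \<open>b n\<close>. If the series converges in norm, this
  is the order of the algebra. Otherwise the increasing partial sums are compared with \<open>a\<close> in the
  weak sense, that is, in the order of the bidual tested on positive functionals, where the sum
  may take the value infinity.
\<close>

definition le_series :: "'a::unital_cstar_algebra \<Rightarrow> (nat \<Rightarrow> 'a) \<Rightarrow> bool"
  where "le_series a b \<longleftrightarrow>
    (if summable b then a \<preceq> (\<Sum>n. b n)
     else \<forall>\<phi>. positive_functional \<phi> \<longrightarrow> ennreal (Re (\<phi> a)) \<le> (\<Sum>n. ennreal (Re (\<phi> (b n)))))"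


section \<open>Hilbert modules\<close>

text \<open>
  The class \<open>banach\<close> supplies the norm topology and completeness. The complex scalar
  multiplication on a module over a unital algebra is necessarily \<open>\<lambda>c x. (c *\<^sub>C 1) \<cdot> x\<close>, so it is
  not a separate parameter. Definiteness of the inner product follows from \<open>norm_eq\<close>.
\<close>

locale hilbert_module =
  fixes act :: "'a::unital_cstar_algebra \<Rightarrow> 'e::banach \<Rightarrow> 'e" (infixr \<open>\<cdot>\<close> 75)
    and ip :: "'e \<Rightarrow> 'e \<Rightarrow> 'a"
  assumes act_add_left: "(a + b) \<cdot> x = a \<cdot> x + b \<cdot> x"
    and act_add_right: "a \<cdot> (x + y) = a \<cdot> x + a \<cdot> y"
    and act_act: "a \<cdot> (b \<cdot> x) = (a * b) \<cdot> x"
    and act_one: "1 \<cdot> x = x"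
    and act_of_real: "(of_real r :: 'a) \<cdot> x = r *\<^sub>R x"
    and ip_add_left: "ip (x + y) z = ip x z + ip y z"
    and ip_act_left: "ip (a \<cdot> x) y = a * ip x y"
    and ip_star: "(ip x y)\<^sup>\<star> = ip y x"
    and ip_pos: "cstar_pos (ip x x)"
    and norm_eq: "norm x = sqrt (norm (ip x x))"

definition module_span :: "('a \<Rightarrow> 'e \<Rightarrow> 'e) \<Rightarrow> 'e set \<Rightarrow> 'e::ab_group_add set"
  where "module_span act G = {\<Sum>g\<in>S. act (c g) g | S c. finite S \<and> S \<subseteq> G}"

text \<open>Finite generation is algebraic, countable generation is topological.\<close>

definition finitely_generated :: "('a \<Rightarrow> 'e \<Rightarrow> 'e::real_normed_vector) \<Rightarrow> bool"
  where "finitely_generated act \<longleftrightarrow> (\<exists>G. finite G \<and> module_span act G = UNIV)"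

definition countably_generated :: "('a \<Rightarrow> 'e \<Rightarrow> 'e::real_normed_vector) \<Rightarrow> bool"
  where "countably_generated act \<longleftrightarrow> (\<exists>G. countable G \<and> closure (module_span act G) = UNIV)"

text \<open>
  A bounded module map with bounded inverse; complex linearity is contained in linearity over the
  algebra. Adjointability is not required of the map or of its inverse.
\<close>

definition bounded_module_map ::
    "('a \<Rightarrow> 'e \<Rightarrow> 'e) \<Rightarrow> ('a \<Rightarrow> 'f \<Rightarrow> 'f) \<Rightarrow> ('e::real_normed_vector \<Rightarrow> 'f::real_normed_vector) \<Rightarrow> bool"
  where "bounded_module_map actE actF T \<longleftrightarrow>
    bounded_linear T \<and> (\<forall>a x. T (actE a x) = actF a (T x))"

definition invertible_operator ::
    "('a \<Rightarrow> 'e \<Rightarrow> 'e) \<Rightarrow> ('a \<Rightarrow> 'f \<Rightarrow> 'f) \<Rightarrow> ('e::real_normed_vector \<Rightarrow> 'f::real_normed_vector) \<Rightarrow> bool"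
  where "invertible_operator actE actF T \<longleftrightarrow>
    bounded_module_map actE actF T \<and>
    (\<exists>S. bounded_module_map actF actE S \<and> (\<forall>x. S (T x) = x) \<and> (\<forall>y. T (S y) = y))"


section \<open>The standard module of square-summable sequences\<close>

definition l2 :: "(nat \<Rightarrow> 'a::unital_cstar_algebra) set"
  where "l2 = {a. summable (\<lambda>n. a n * (a n)\<^sup>\<star>)}"

definition l2_ip :: "(nat \<Rightarrow> 'a::unital_cstar_algebra) \<Rightarrow> (nat \<Rightarrow> 'a) \<Rightarrow> 'a"
  where "l2_ip a b = (\<Sum>n. a n * (b n)\<^sup>\<star>)"

text \<open>
  Membership in \<open>L(\<ell>\<^sup>2(A))\<close>; only the values on the carrier \<open>l2\<close> matter. As usual, linearity and
  boundedness are consequences of the existence of an adjoint.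
\<close>

definition l2_adjointable :: "((nat \<Rightarrow> 'a::unital_cstar_algebra) \<Rightarrow> (nat \<Rightarrow> 'a)) \<Rightarrow> bool"
  where "l2_adjointable U \<longleftrightarrow>
    (\<forall>a\<in>l2. U a \<in> l2) \<and>
    (\<exists>V. (\<forall>b\<in>l2. V b \<in> l2) \<and> (\<forall>a\<in>l2. \<forall>b\<in>l2. l2_ip (U a) b = l2_ip a (V b)))"


section \<open>Bessel sequences, the lower frame condition and generalized multipliers\<close>

definition standard_bessel ::
    "('e \<Rightarrow> 'e \<Rightarrow> 'a::unital_cstar_algebra) \<Rightarrow> (nat \<Rightarrow> 'e) \<Rightarrow> real \<Rightarrow> bool"
  where "standard_bessel ip X D \<longleftrightarrow> D > 0 \<and>
    (\<forall>x. summable (\<lambda>n. ip x (X n) * ip (X n) x) \<and>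
         (\<Sum>n. ip x (X n) * ip (X n) x) \<preceq> D *\<^sub>R ip x x)"

definition lower_frame_condition ::
    "('e \<Rightarrow> 'e \<Rightarrow> 'a::unital_cstar_algebra) \<Rightarrow> (nat \<Rightarrow> 'e) \<Rightarrow> bool"
  where "lower_frame_condition ip X \<longleftrightarrow>
    (\<exists>C>0. \<forall>x. le_series (C *\<^sub>R ip x x) (\<lambda>n. ip x (X n) * ip (X n) x))"

definition analysis_op :: "('e \<Rightarrow> 'e \<Rightarrow> 'a) \<Rightarrow> (nat \<Rightarrow> 'e) \<Rightarrow> 'e \<Rightarrow> nat \<Rightarrow> 'a"
  where "analysis_op ip X x = (\<lambda>n. ip x (X n))"

definition multiplier_term ::
    "('e \<Rightarrow> 'e \<Rightarrow> 'a) \<Rightarrow> ('a \<Rightarrow> 'f \<Rightarrow> 'f) \<Rightarrow> ((nat \<Rightarrow> 'a) \<Rightarrow> nat \<Rightarrow> 'a) \<Rightarrow>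
     (nat \<Rightarrow> 'f) \<Rightarrow> (nat \<Rightarrow> 'e) \<Rightarrow> 'e \<Rightarrow> nat \<Rightarrow> 'f"
  where "multiplier_term ipE actF U Y X x = (\<lambda>n. actF (U (analysis_op ipE X x) n) (Y n))"

text \<open>Meaningful only if the series converges for every \<open>x\<close>, which has to be assumed separately.\<close>

definition multiplier ::
    "('e \<Rightarrow> 'e \<Rightarrow> 'a) \<Rightarrow> ('a \<Rightarrow> 'f \<Rightarrow> 'f::real_normed_vector) \<Rightarrow> ((nat \<Rightarrow> 'a) \<Rightarrow> nat \<Rightarrow> 'a) \<Rightarrow>
     (nat \<Rightarrow> 'f) \<Rightarrow> (nat \<Rightarrow> 'e) \<Rightarrow> 'e \<Rightarrow> 'f"
  where "multiplier ipE actF U Y X x = (\<Sum>n. multiplier_term ipE actF U Y X x n)"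

end

theory Submission
  imports Defs
begin

text \<open>
  Let \<open>S\<close> be the inverse of the multiplier and \<open>c = U T\<^sub>X S y\<close>, so that \<open>y = (\<Sum>n. c n \<cdot> Y n)\<close>
  and, with \<open>b n = \<langle>y, Y n\<rangle>\<close>, \<open>\<langle>y, y\<rangle> = (\<Sum>n. c n * (b n)\<^sup>\<star>)\<close>. If \<open>\<langle>c, c\<rangle> \<le> K \<langle>y, y\<rangle>\<close>,
  then expanding \<open>0 \<le> \<langle>c - K b, c - K b\<rangle>\<close> on partial sums gives \<open>\<langle>y, y\<rangle> \<le> K \<langle>b, b\<rangle>\<close>. The constant
  \<open>K\<close> comes from uniform boundedness, which makes \<open>y \<mapsto> c\<close> bounded in norm, followed by Paschke's
  argument turning the norm bound of a module map into an inequality in the algebra.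
\<close>

section \<open>Positive elements of a unital C*-algebra\<close>

lemma star_zero [simp]: "(0::'a::unital_cstar_algebra)\<^sup>\<star> = 0"
  using star_add[of "0::'a" 0] by simp

lemma star_minus [simp]: "(- a)\<^sup>\<star> = - (a\<^sup>\<star>)" for a :: "'a::unital_cstar_algebra"
  using star_add[of a "- a"] by (simp add: add_eq_0_iff)

lemma star_diff [simp]: "(a - b)\<^sup>\<star> = a\<^sup>\<star> - b\<^sup>\<star>" for a :: "'a::unital_cstar_algebra"
  using star_add[of a "- b"] by simp

lemma star_one [simp]: "(1::'a::unital_cstar_algebra)\<^sup>\<star> = 1"
  using star_mult[of "(1::'a::unital_cstar_algebra)\<^sup>\<star>" 1] by (simp add: star_star)

lemma star_scaleR [simp]: "(r *\<^sub>R a)\<^sup>\<star> = r *\<^sub>R a\<^sup>\<star>" for a :: "'a::unital_cstar_algebra"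
  using star_scaleC[of "complex_of_real r" a] by (simp add: scaleC_of_real)

lemma star_power [simp]: "(a ^ n)\<^sup>\<star> = (a\<^sup>\<star>) ^ n" for a :: "'a::unital_cstar_algebra"
  by (induction n) (simp_all add: star_mult power_commutes)

lemma norm_star [simp]: "norm (a\<^sup>\<star>) = norm a" for a :: "'a::unital_cstar_algebra"
proof -
  have *: "norm b \<le> norm (b\<^sup>\<star>)" for b :: 'a
  proof (cases "b = 0")
    case False
    have "norm b * norm b \<le> norm (b\<^sup>\<star>) * norm b"
      using cstar_identity[of b] norm_mult_ineq[of "b\<^sup>\<star>" b] by (simp add: power2_eq_square)
    then show ?thesis using False by simp
  qed simp
  show ?thesis using *[of a] *[of "a\<^sup>\<star>"] by (simp add: star_star)
qed

lemma norm_mult_star: "norm (a * a\<^sup>\<star>) = (norm a)\<^sup>2" for a :: "'a::unital_cstar_algebra"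
  using cstar_identity[of "a\<^sup>\<star>"] by (simp add: star_star)

lemma norm_square: "a\<^sup>\<star> = a \<Longrightarrow> norm (a * a) = (norm a)\<^sup>2" for a :: "'a::unital_cstar_algebra"
  using cstar_identity[of a] by simp

lemma bounded_linear_star: "bounded_linear (star :: 'a::unital_cstar_algebra \<Rightarrow> 'a)"
  by (rule bounded_linear_intro[where K = 1]) (simp_all add: star_add)

lemmas star_sum = linear_sum[OF bounded_linear.linear[OF bounded_linear_star]]
lemmas star_suminf = bounded_linear.suminf[OF bounded_linear_star]
lemmas tendsto_star = bounded_linear.tendsto[OF bounded_linear_star]

section \<open>The binomial series of sqrt (1 - x), with coefficients
  \<open>sqrt_coeff\<close>\<close>

definition sqrt_coeff :: "nat \<Rightarrow> real"
  where "sqrt_coeff n = ((1/2) gchoose n) * (- 1) ^ n"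

text \<open>Consecutive binomial coefficients have ratio \<open>- (n + 1/2) / (n + 1)\<close>, so
  the signs alternate. The same quantity is the partial sum of \<open>sqrt_coeff\<close> up to
  n.\<close>

lemma gbinomial_minus_half_sign: "(- 1) ^ n * ((- 1/2 :: real) gchoose n) \<ge> 0"
proof (induction n)
  case (Suc n)
  have "(- 1/2) * ((- 1/2 :: real) gchoose n)
    = real n * ((- 1/2) gchoose n) + real (Suc n) * ((- 1/2) gchoose Suc n)"
    by (rule gbinomial_mult_1)
  then have "((- 1/2 :: real) gchoose Suc n) = - ((real n + 1/2) / (n + 1)) * ((- 1/2) gchoose n)"
    by (simp add: field_simps)
  then have "(- 1) ^ Suc n * ((- 1/2 :: real) gchoose Suc n)
    = ((- 1) ^ n * ((- 1/2) gchoose n)) * ((real n + 1/2) / (n + 1))"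
    by simp
  then show ?case using Suc by simp
qed simp

lemma sqrt_coeff_nonpos:
  assumes "n > 0" shows "sqrt_coeff n \<le> 0"
proof -
  obtain m where m: "n = Suc m" using assms gr0_implies_Suc by blast
  have "sqrt_coeff n = - (1 / (2 * (m + 1))) * ((- 1) ^ m * ((- 1/2) gchoose m))"
    using gbinomial_absorption[of m "1/2::real"] by (simp add: sqrt_coeff_def m field_simps)
  then show ?thesis using gbinomial_minus_half_sign[of m]
    by (simp add: mult_nonneg_nonneg)
qed

text \<open>Only the constant coefficient 1 is positive, so the absolute sum is 2 minus the plain
  sum, whose closed form is nonnegative.\<close>

lemma sum_abs_sqrt_coeff_le: "(\<Sum>k\<le>n. \<bar>sqrt_coeff k\<bar>) \<le> 2"
proof -
  have "(\<Sum>k\<le>n. \<bar>sqrt_coeff k\<bar>) = (\<Sum>k\<le>n. (if k = 0 then 2 else 0) - sqrt_coeff k)"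
    by (rule sum.cong) (use sqrt_coeff_nonpos in \<open>auto simp: sqrt_coeff_def[of 0]\<close>)
  also have "\<dots> = 2 - (\<Sum>k\<le>n. sqrt_coeff k)"
    by (simp add: sum_subtractf)
  also have "(\<Sum>k\<le>n. sqrt_coeff k) = (- 1) ^ n * ((- 1/2) gchoose n)"
    using gbinomial_sum_lower_neg[of "1/2::real" n] by (simp add: sqrt_coeff_def)
  finally show "(\<Sum>k\<le>n. \<bar>sqrt_coeff k\<bar>) \<le> 2"
    using gbinomial_minus_half_sign[of n] by simp
qed

lemma summable_sqrt_coeff: "summable (\<lambda>n. \<bar>sqrt_coeff n\<bar>)"
  by (rule bounded_imp_summable[OF _ sum_abs_sqrt_coeff_le]) simp

lemma suminf_abs_sqrt_coeff_Suc_le: "(\<Sum>n. \<bar>sqrt_coeff (Suc n)\<bar>) \<le> 1"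
proof -
  have "(\<Sum>n. \<bar>sqrt_coeff n\<bar>) \<le> 2"
  proof (rule suminf_le_const[OF summable_sqrt_coeff])
    show "(\<Sum>k<n. \<bar>sqrt_coeff k\<bar>) \<le> 2" for n
      using sum_abs_sqrt_coeff_le[of n] by (simp add: lessThan_Suc_atMost[symmetric])
  qed
  then show ?thesis
    using suminf_split_head[OF summable_sqrt_coeff] by (simp add: sqrt_coeff_def[of 0])
qed

text \<open>Vandermonde's identity with 1/2 + 1/2 = 1: the series squares to 1 - x.\<close>

lemma sqrt_coeff_convolution:
  "(\<Sum>i\<le>n. sqrt_coeff i * sqrt_coeff (n - i)) = (if n = 0 then 1 else if n = 1 then - 1 else 0)"
proof -
  have "(\<Sum>i\<le>n. sqrt_coeff i * sqrt_coeff (n - i))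
    = (\<Sum>i\<le>n. ((1/2) gchoose i) * ((1/2) gchoose (n - i))) * (- 1) ^ n"
    unfolding sum_distrib_right sqrt_coeff_def
    by (rule sum.cong) (auto simp flip: power_add)
  also have "(\<Sum>i\<le>n. ((1/2) gchoose i) * ((1/2) gchoose (n - i))) = ((1::real) gchoose n)"
    using gbinomial_Vandermonde[of "1/2::real" "1/2" n] by (simp add: atMost_atLeast0)
  also have "((1::real) gchoose n) = real (1 choose n)"
    using binomial_gbinomial[of 1 n, where 'a = real] by simp
  finally show ?thesis by (cases "n > 1") (auto simp: binomial_eq_0 not_less le_Suc_eq)
qed

text \<open>Absolute summability of the coefficients gives norm convergence even when
  \<open>norm x = 1\<close>. Their absolute values from index 1 on add up to at most 1, which bounds
  \<open>1 - b\<close>. The commutation clause passes from powers of x to the limit and later makes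
  square roots commute with each other.\<close>

lemma star_sqrt_one_minus:
  fixes x :: "'a::unital_cstar_algebra"
  assumes "norm x \<le> 1" and "x\<^sup>\<star> = x"
  obtains b where "norm (1 - b) \<le> 1" "b\<^sup>\<star> = b" "b * b = 1 - x" "\<And>c. c * x = x * c \<Longrightarrow> c * b = b * c"
proof
  let ?f = "\<lambda>n. sqrt_coeff n *\<^sub>R x ^ n"
  let ?b = "\<Sum>n. ?f n"
  have le: "norm (?f n) \<le> \<bar>sqrt_coeff n\<bar>" for n
  proof -
    have "norm (x ^ n) \<le> 1" using norm_power_ineq[of x n] power_le_one[OF _ assms(1), of n] by simp
    then show ?thesis by (simp add: mult_left_le)
  qed
  then have nf: "summable (\<lambda>n. norm (?f n))"
    by (intro summable_comparison_test[OF _ summable_sqrt_coeff]) auto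
  then have sf: "summable ?f" by (rule summable_norm_cancel)
  show "norm (1 - ?b) \<le> 1"
  proof -
    have "1 - ?b = - (\<Sum>n. ?f (Suc n))"
      using suminf_split_head[OF sf] by (simp add: sqrt_coeff_def[of 0])
    then have "norm (1 - ?b) = norm (\<Sum>n. ?f (Suc n))" by simp
    also have "\<dots> \<le> (\<Sum>n. \<bar>sqrt_coeff (Suc n)\<bar>)"
      by (rule norm_suminf_le[OF le]) (use summable_sqrt_coeff in \<open>simp add: summable_Suc_iff[of "\<lambda>n. \<bar>sqrt_coeff n\<bar>"]\<close>)
    finally show ?thesis using suminf_abs_sqrt_coeff_Suc_le by simp
  qed
  show "?b\<^sup>\<star> = ?b" using star_suminf[OF sf] assms(2) by simp
  show "c * ?b = ?b * c" if "c * x = x * c" for c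
    using suminf_mult[OF sf, of c] suminf_mult2[OF sf, of c] power_commuting_commutes[OF that[symmetric]]
    by simp
  have "(\<Sum>i\<le>n. ?f i * ?f (n - i)) = (\<Sum>i\<le>n. sqrt_coeff i * sqrt_coeff (n - i)) *\<^sub>R x ^ n" for n
    unfolding scaleR_sum_left by (rule sum.cong) (auto simp flip: power_add)
  then have "(\<lambda>n. (if n = 0 then 1 else if n = 1 then - 1 else 0) *\<^sub>R x ^ n) sums (?b * ?b)"
    using Cauchy_product_sums[OF nf nf] by (simp add: sqrt_coeff_convolution)
  moreover have "(\<lambda>n. (if n = 0 then 1 else if n = 1 then - 1 else 0) *\<^sub>R x ^ n) sums
      (\<Sum>n\<in>{0,1}. (if n = 0 then 1 else if n = 1 then - 1 else 0) *\<^sub>R x ^ n)"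
    by (rule sums_finite) auto
  ultimately show "?b * ?b = 1 - x" by (auto dest: sums_unique2)
qed

text \<open>Positivity is first handled through the norm criterion, which is visibly stable under sums
  and limits. That it agrees with \<open>cstar_pos\<close> is Kelley and Vaught's theorem.\<close>

definition norm_pos :: "'a::unital_cstar_algebra \<Rightarrow> bool"
  where "norm_pos a \<longleftrightarrow> a\<^sup>\<star> = a \<and> (\<exists>t. norm (of_real t - a) \<le> t)"

text \<open>For t > 0 the criterion says that \<open>1 - (1 / t) *\<^sub>R a\<close> has norm at
  most 1, so the binomial series applies and its value is rescaled by \<open>sqrt t\<close>. The
  bound on \<open>1 - b\<close> makes the root itself satisfy the criterion.\<close>

lemma norm_pos_sqrt:
  fixes a :: "'a::unital_cstar_algebra"
  assumes "norm_pos a"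
  obtains b where "norm_pos b" "b\<^sup>\<star> = b" "b * b = a" "\<And>c. c * a = a * c \<Longrightarrow> c * b = b * c"
proof -
  obtain t where sa: "a\<^sup>\<star> = a" and t: "norm (of_real t - a) \<le> t"
    using assms by (auto simp: norm_pos_def)
  show ?thesis
  proof (cases "t > 0")
    case False
    then have "t = 0" using t norm_ge_zero[of "of_real t - a"] by linarith
    then have "a = 0" using t by simp
    then show ?thesis using that[of 0] by (auto simp: norm_pos_def)
  next
    case True
    let ?x = "1 - (1 / t) *\<^sub>R a"
    have "?x = (1 / t) *\<^sub>R (of_real t - a)"
      using True by (simp add: scaleR_diff_right of_real_def)
    then have "norm ?x \<le> 1" using t True by simp
    moreover have "?x\<^sup>\<star> = ?x" using sa by simp
    ultimately show ?thesis
    proof (rule star_sqrt_one_minus)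
      fix b assume nb: "norm (1 - b) \<le> 1"
        and b: "b\<^sup>\<star> = b" "b * b = 1 - ?x" "\<And>c. c * ?x = ?x * c \<Longrightarrow> c * b = b * c"
      show ?thesis
      proof (rule that)
        show "(sqrt t *\<^sub>R b)\<^sup>\<star> = sqrt t *\<^sub>R b" using b(1) by simp
        have "of_real (sqrt t) - sqrt t *\<^sub>R b = sqrt t *\<^sub>R (1 - b)"
          by (simp add: algebra_simps of_real_def)
        then have "norm (of_real (sqrt t) - sqrt t *\<^sub>R b) \<le> sqrt t"
          using nb True by (simp add: mult_left_le)
        then show "norm_pos (sqrt t *\<^sub>R b)" using b(1) by (auto simp: norm_pos_def)
        have "(sqrt t *\<^sub>R b) * (sqrt t *\<^sub>R b) = t *\<^sub>R (b * b)" using True by simp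
        then show "(sqrt t *\<^sub>R b) * (sqrt t *\<^sub>R b) = a" using True by (simp add: b(2))
        show "c * (sqrt t *\<^sub>R b) = (sqrt t *\<^sub>R b) * c" if "c * a = a * c" for c
        proof -
          have "c * b = b * c" by (rule b(3)) (use that in \<open>simp add: algebra_simps\<close>)
          then show ?thesis by simp
        qed
      qed
    qed
  qed
qed

text \<open>Since b and d commute, the C*-identity for b + i d gives it the squared norm t, and its
  real part b has no larger norm.\<close>

lemma norm_le_of_commuting_squares:
  fixes b d :: "'a::unital_cstar_algebra"
  assumes b: "b\<^sup>\<star> = b" and d: "d\<^sup>\<star> = d" and bd: "b * d = d * b"
    and sum: "b * b + d * d = of_real t" and t: "0 \<le> t"
  shows "norm (b * b) \<le> t"
proof -
  define e where "e = \<i> *\<^sub>C d"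
  have minus: "(- 1) *\<^sub>C a = - a" for a :: 'a
    using scaleC_of_real[of "- 1" a] by simp
  have star_e: "e\<^sup>\<star> = - e"
    using scaleC_scaleC[of "- 1" \<i> d] minus by (simp add: e_def star_scaleC d)
  have ee: "e * e = - (d * d)" and be: "b * e = e * b"
    by (simp_all add: e_def mult_scaleC_left mult_scaleC_right scaleC_scaleC minus bd)
  have star_u: "(b + e)\<^sup>\<star> = b - e"
    by (simp add: star_add star_e b)
  have "(b - e) * (b + e) = b * b + d * d"
    by (simp add: algebra_simps ee be)
  then have u: "(norm (b + e))\<^sup>2 = t"
    using cstar_identity[of "b + e"] star_u sum t by simp
  have "norm (2 *\<^sub>R b) = norm ((b + e) + (b - e))"
    by (simp add: scaleR_2)
  also have "\<dots> \<le> 2 * norm (b + e)"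
    using norm_triangle_ineq[of "b + e" "b - e"] norm_star[of "b + e"] star_u by simp
  finally have "(norm b)\<^sup>2 \<le> (norm (b + e))\<^sup>2"
    by (intro power_mono) simp_all
  then show ?thesis
    using norm_square[OF b] u by simp
qed

lemma star_of_real [simp]: "(of_real t :: 'a::unital_cstar_algebra)\<^sup>\<star> = of_real t"
  by (simp add: of_real_def)

text \<open>The element \<open>of_real t - b * b\<close> is a square of a self-adjoint element
  commuting with b, so the preceding estimate applies with the two squares exchanged.\<close>

lemma norm_of_real_minus_square:
  fixes b :: "'a::unital_cstar_algebra"
  assumes b: "b\<^sup>\<star> = b" and t: "norm (b * b) \<le> t"
  shows "norm (of_real t - b * b) \<le> t"
proof (cases "t > 0")
  case False
  then have "t = 0" using t norm_ge_zero[of "b * b"] by linarith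
  then show ?thesis using t by simp
next
  case True
  let ?x = "(1 / t) *\<^sub>R (b * b)"
  have "norm ?x \<le> 1" "?x\<^sup>\<star> = ?x" using t True b by (simp_all add: star_mult)
  then show ?thesis
  proof (rule star_sqrt_one_minus)
    fix d assume d: "d\<^sup>\<star> = d" "d * d = 1 - ?x" "\<And>c. c * ?x = ?x * c \<Longrightarrow> c * d = d * c"
    let ?d = "sqrt t *\<^sub>R d"
    have bd: "b * d = d * b" by (rule d(3)) (simp add: mult.assoc)
    have "?d * ?d = t *\<^sub>R (d * d)" using True by simp
    then have dd: "?d * ?d = of_real t - b * b"
      using True by (simp add: d(2) algebra_simps of_real_def)
    have "norm (?d * ?d) \<le> t"
      by (rule norm_le_of_commuting_squares[where d = b]) (use b d(1) bd dd True in simp_all)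
    then show ?thesis by (simp only: dd)
  qed
qed

lemma norm_pos_square: "b\<^sup>\<star> = b \<Longrightarrow> norm_pos (b * b)"
  using norm_of_real_minus_square by (fastforce simp: norm_pos_def star_mult)

lemma norm_pos_star: "norm_pos a \<Longrightarrow> a\<^sup>\<star> = a"
  by (simp add: norm_pos_def)

text \<open>Every t above the norm can serve as the witness in \<open>norm_pos\<close>; closedness
  under limits rests on this uniformity.\<close>

lemma norm_pos_bound: "norm_pos a \<Longrightarrow> norm a \<le> t \<Longrightarrow> norm (of_real t - a) \<le> t"
  by (erule norm_pos_sqrt) (use norm_of_real_minus_square in blast)

lemma norm_pos_add:
  assumes "norm_pos a" "norm_pos b" shows "norm_pos (a + b)"
proof -
  obtain s t where "norm (of_real s - a) \<le> s" "norm (of_real t - b) \<le> t"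
    using assms by (auto simp: norm_pos_def)
  then have "norm ((of_real s - a) + (of_real t - b)) \<le> s + t"
    by (intro norm_triangle_le add_mono)
  then have "norm (of_real (s + t) - (a + b)) \<le> s + t"
    by (simp add: algebra_simps)
  then show ?thesis using assms unfolding norm_pos_def by (metis star_add)
qed

lemma norm_pos_scaleR:
  fixes a :: "'a::unital_cstar_algebra"
  assumes "norm_pos a" "r \<ge> 0" shows "norm_pos (r *\<^sub>R a)"
proof -
  have "norm_pos (r *\<^sub>R (b * b))" if "b\<^sup>\<star> = b" for b :: 'a
    using norm_pos_square[of "sqrt r *\<^sub>R b"] that assms(2) by simp
  then show ?thesis by (metis norm_pos_sqrt[OF assms(1)])
qed

text \<open>A convergent sequence is bounded, so one t serves all its terms and the closed condition
  survives in the limit.\<close>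

lemma norm_pos_lim:
  assumes lim: "a \<longlonglongrightarrow> l" and pos: "\<And>n. norm_pos (a n)"
  shows "norm_pos l"
proof -
  obtain t where t: "\<And>n. norm (a n) \<le> t"
    using Bseq_def convergent_def convergent_imp_Bseq lim by metis
  have "(\<lambda>n. (a n)\<^sup>\<star>) \<longlonglongrightarrow> l\<^sup>\<star>" by (rule tendsto_star[OF lim])
  then have "l\<^sup>\<star> = l"
    using LIMSEQ_unique lim by (simp add: norm_pos_star[OF pos])
  moreover have "norm (of_real t - l) \<le> t"
  proof (rule LIMSEQ_le_const2)
    show "(\<lambda>n. norm (of_real t - a n)) \<longlonglongrightarrow> norm (of_real t - l)"
      by (intro tendsto_intros lim)
  qed (use norm_pos_bound[OF pos t] in blast)
  ultimately show ?thesis by (auto simp: norm_pos_def)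
qed

text \<open>The roots b of a and d of \<open>of_real t - a\<close> commute, and their squares add up
  to t.\<close>

lemma norm_le_of_norm_pos:
  assumes a: "norm_pos a" and ta: "norm_pos (of_real t - a)" and t: "0 \<le> t"
  shows "norm a \<le> t"
proof (rule norm_pos_sqrt[OF a])
  fix b assume b: "b\<^sup>\<star> = b" "b * b = a"
  show ?thesis
  proof (rule norm_pos_sqrt[OF ta])
    fix d assume d: "d\<^sup>\<star> = d" "d * d = of_real t - a"
      "\<And>c. c * (of_real t - a) = (of_real t - a) * c \<Longrightarrow> c * d = d * c"
    have "b * d = d * b"
      by (rule d(3)) (simp add: algebra_simps flip: b(2), simp add: of_real_def)
    then have "norm (b * b) \<le> t"
      by (rule norm_le_of_commuting_squares[OF b(1) d(1)]) (simp_all add: b(2) d(2) t)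
    then show ?thesis by (simp add: b(2))
  qed
qed

lemma norm_pos_antisym:
  assumes "norm_pos a" "norm_pos (- a)" shows "a = 0"
  using norm_le_of_norm_pos[of a 0] assms by simp

section \<open>The Kelley-Vaught theorem\<close>

lemma norm_power_two_power:
  fixes b :: "'a::unital_cstar_algebra"
  assumes "b\<^sup>\<star> = b" shows "norm (b ^ (2 ^ k)) = norm b ^ (2 ^ k)"
proof (induction k)
  case (Suc k)
  have "norm (b ^ (2 ^ Suc k)) = norm (b ^ (2 ^ k) * b ^ (2 ^ k))"
    by (simp add: mult_2 power_add)
  also have "\<dots> = (norm (b ^ (2 ^ k)))\<^sup>2"
    by (rule norm_square) (simp add: assms)
  finally show ?case using Suc by (simp add: mult_2 power_add power2_eq_square)
qed simp

text \<open>For self-adjoint b the norms at exponents \<open>2 ^ k\<close> are exact powers of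
  \<open>norm b\<close>; if that exceeded 1, they would outgrow any linear bound.\<close>

lemma norm_le_one_of_linear_growth:
  fixes b :: "'a::unital_cstar_algebra"
  assumes b: "b\<^sup>\<star> = b" and growth: "\<And>n. norm (b ^ n) \<le> 1 + real n"
  shows "norm b \<le> 1"
proof (rule ccontr)
  assume "\<not> norm b \<le> 1"
  then have nb: "norm b > 1" by simp
  then have "0 < norm b" by linarith
  then have r: "norm (1 / norm b) < 1" "0 < norm b" using nb by (simp_all add: divide_less_eq)
  have "(\<lambda>n. (1 / norm b) ^ n + real n * (1 / norm b) ^ n) \<longlonglongrightarrow> 0 + 0"
    by (intro tendsto_add LIMSEQ_power_zero powser_times_n_limit_0 r)
  then have "eventually (\<lambda>n. (1 / norm b) ^ n + real n * (1 / norm b) ^ n < 1) sequentially"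
    by (intro order_tendstoD(2)) auto
  then obtain N where "\<And>n. n \<ge> N \<Longrightarrow> (1 / norm b) ^ n + real n * (1 / norm b) ^ n < 1"
    by (auto simp: eventually_sequentially)
  \<comment> \<open>The exponent has to be a power of two and at least N; \<open>N < 2 ^ N\<close>
    provides both.\<close>
  from this[of "2 ^ N"] have "(1 + real (2 ^ N)) / norm b ^ (2 ^ N) < 1"
    using less_exp[of N] by (simp add: power_one_over add_divide_distrib)
  then have "1 + real (2 ^ N) < norm b ^ (2 ^ N)"
    using r(2) by (simp add: field_simps)
  then show False using growth[of "2 ^ N"] by (simp add: norm_power_two_power[OF b])
qed

lemma norm_pos_minus_skew_square:
  fixes e :: "'a::unital_cstar_algebra"
  assumes "e\<^sup>\<star> = - e" shows "norm_pos (- (e * e))"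
proof -
  have "(\<i> *\<^sub>C e)\<^sup>\<star> = \<i> *\<^sub>C e"
    using scaleC_scaleC[of "- \<i>" "- 1" e] scaleC_of_real[of "- 1" e] by (simp add: star_scaleC assms)
  moreover have "(\<i> *\<^sub>C e) * (\<i> *\<^sub>C e) = - (e * e)"
    using scaleC_of_real[of "- 1" "e * e"]
    by (simp add: mult_scaleC_left mult_scaleC_right scaleC_scaleC)
  ultimately show ?thesis using norm_pos_square[of "\<i> *\<^sub>C e"] by simp
qed

text \<open>With c and e twice the real and skew parts of y, \<open>c * c - e * e\<close> is twice
  \<open>y * y\<^sup>\<star> + y\<^sup>\<star> * y\<close>. Both squares contribute positively, and
  adding \<open>- (y\<^sup>\<star> * y)\<close> isolates \<open>y * y\<^sup>\<star>\<close>.\<close>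

lemma norm_pos_mult_star_of_norm_pos_minus:
  fixes y :: "'a::unital_cstar_algebra"
  assumes "norm_pos (- (y\<^sup>\<star> * y))" shows "norm_pos (y * y\<^sup>\<star>)"
proof -
  let ?c = "y + y\<^sup>\<star>" and ?e = "y - y\<^sup>\<star>"
  have "norm_pos (?c * ?c)" by (rule norm_pos_square) (simp add: star_add star_star)
  moreover have "norm_pos (- (?e * ?e))"
    by (rule norm_pos_minus_skew_square) (simp add: star_star)
  ultimately have "norm_pos ((1/2) *\<^sub>R (?c * ?c + - (?e * ?e)) + - (y\<^sup>\<star> * y))"
    by (intro norm_pos_add norm_pos_scaleR assms) simp_all
  moreover have "?c * ?c + - (?e * ?e) = 2 *\<^sub>R (y * y\<^sup>\<star> + y\<^sup>\<star> * y)"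
    by (simp add: algebra_simps scaleR_2)
  ultimately show ?thesis by simp
qed

text \<open>With \<open>w = - y\<^sup>\<star> * y\<close>, the intertwining \<open>(1 - y * y\<^sup>\<star>) * y = y * (1 + w)\<close> makes the
  powers of \<open>1 + w\<close> grow at most linearly, which forces \<open>norm (1 + w) \<le> 1\<close> and hence \<open>- w \<ge> 0\<close>.
  This replaces the usual comparison of the spectra of \<open>y\<^sup>\<star> * y\<close> and \<open>y * y\<^sup>\<star>\<close>.\<close>

lemma eq_zero_of_norm_pos_minus_normalized:
  fixes y :: "'a::unital_cstar_algebra"
  assumes w_pos: "norm_pos (- (y\<^sup>\<star> * y))" and ny: "norm y = 1"
  shows False
proof -
  define w where "w = - (y\<^sup>\<star> * y)"
  define A where "A = 1 - y * y\<^sup>\<star>"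
  have "norm A \<le> 1"
    using norm_pos_bound[OF norm_pos_mult_star_of_norm_pos_minus[OF w_pos], of 1]
    by (simp add: A_def norm_mult_star ny)
  have intertwine: "A ^ n * y = y * (1 + w) ^ n" for n
  proof (induction n)
    case (Suc n)
    have "A ^ Suc n * y = A * (A ^ n * y)" by (simp add: mult.assoc)
    also have "\<dots> = (A * y) * (1 + w) ^ n" by (simp add: Suc mult.assoc)
    also have "A * y = y * (1 + w)" by (simp add: A_def w_def algebra_simps)
    finally show ?case by (simp add: mult.assoc)
  qed simp
  have wn: "norm ((1 + w) ^ n * w) \<le> 1" for n
  proof -
    have "norm (A ^ n) \<le> 1"
      using norm_power_ineq[of A n] power_le_one[OF _ \<open>norm A \<le> 1\<close>, of n] by simp
    then have "norm (A ^ n * y) \<le> 1"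
      using norm_mult_ineq[of "A ^ n" y] ny by simp
    then have "norm (y\<^sup>\<star> * (A ^ n * y)) \<le> 1"
      using norm_mult_ineq[of "y\<^sup>\<star>" "A ^ n * y"] ny by simp
    moreover have "(1 + w) ^ n * w = w * (1 + w) ^ n"
      by (rule power_commuting_commutes) (simp add: algebra_simps)
    moreover have "w * (1 + w) ^ n = - (y\<^sup>\<star> * (A ^ n * y))"
      by (simp add: intertwine) (simp add: w_def mult.assoc)
    ultimately show ?thesis by simp
  qed
  \<comment> \<open>Passing from n to n + 1 adds \<open>(1 + w) ^ n * w\<close>, which has norm at
    most 1 by \<open>wn\<close>.\<close>
  have "norm ((1 + w) ^ n) \<le> 1 + real n" for n
  proof (induction n)
    case (Suc n)
    have "(1 + w) ^ Suc n = (1 + w) ^ n + (1 + w) ^ n * w"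
      by (simp only: power_Suc2 distrib_left mult_1_right)
    then show ?case
      using norm_triangle_ineq[of "(1 + w) ^ n" "(1 + w) ^ n * w"] wn[of n] Suc by simp
  qed simp
  then have "norm (1 + w) \<le> 1"
    by (rule norm_le_one_of_linear_growth[rotated])
      (simp add: star_add norm_pos_star[OF w_pos[folded w_def]])
  then have "norm (of_real 1 - (- w)) \<le> 1" by simp
  moreover have "(- w)\<^sup>\<star> = - w"
    using norm_pos_star[OF w_pos[folded w_def]] by simp
  ultimately have "norm_pos (- w)" unfolding norm_pos_def by blast
  then have "w = 0" using norm_pos_antisym[of w] w_pos by (simp add: w_def)
  then show False using cstar_identity[of y] ny by (simp add: w_def)
qed

lemma eq_zero_of_norm_pos_minus:
  fixes y :: "'a::unital_cstar_algebra"
  assumes "norm_pos (- (y\<^sup>\<star> * y))" shows "y = 0"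
proof (rule ccontr)
  assume "y \<noteq> 0"
  let ?z = "(1 / norm y) *\<^sub>R y"
  have "- (?z\<^sup>\<star> * ?z) = (1 / norm y)\<^sup>2 *\<^sub>R (- (y\<^sup>\<star> * y))"
    by (simp add: power2_eq_square)
  then have "norm_pos (- (?z\<^sup>\<star> * ?z))"
    using norm_pos_scaleR[OF assms, of "(1 / norm y)\<^sup>2"] by (simp only:) simp
  then show False
    by (rule eq_zero_of_norm_pos_minus_normalized) (use \<open>y \<noteq> 0\<close> in simp)
qed

text \<open>Here p plays the role of the absolute value of h, and q of twice its negative part. Then
  \<open>(x * q)\<^sup>\<star> * (x * q) = - (q * p * q)\<close> is the negative of a positive
  element, so \<open>x * q = 0\<close> and \<open>q * p * q = 0\<close>. As \<open>q * q\<close> is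
  twice \<open>q * p\<close>, the cube of q vanishes; q is self-adjoint, so it is 0 and h =
  p.\<close>

lemma norm_pos_star_mult:
  fixes x :: "'a::unital_cstar_algebra"
  shows "norm_pos (x\<^sup>\<star> * x)"
proof -
  define h where "h = x\<^sup>\<star> * x"
  have h: "h\<^sup>\<star> = h" by (simp add: h_def star_mult star_star)
  show ?thesis unfolding h_def[symmetric]
  proof (rule norm_pos_sqrt[OF norm_pos_square[OF h]])
    fix p assume p: "norm_pos p" "p\<^sup>\<star> = p" "p * p = h * h"
      and "\<And>c. c * (h * h) = (h * h) * c \<Longrightarrow> c * p = p * c"
    then have hp: "h * p = p * h" by (simp add: mult.assoc)
    define q where "q = p - h"
    have q: "q\<^sup>\<star> = q" by (simp add: q_def h p(2))
    have qh: "q * h = - (q * p)"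
      by (simp add: q_def algebra_simps hp p(3))
    have qp: "q * p = p * q" by (simp add: q_def algebra_simps hp)
    have star_xq: "(x * q)\<^sup>\<star> * (x * q) = - (q * p * q)"
    proof -
      have "(x * q)\<^sup>\<star> * (x * q) = q * h * q" by (simp add: star_mult q h_def mult.assoc)
      then show ?thesis by (simp add: qh)
    qed
    \<comment> \<open>With e the root of p, which commutes with q, this is the square of the
      self-adjoint \<open>q * e\<close>.\<close>
    have "norm_pos (q * p * q)"
    proof (rule norm_pos_sqrt[OF p(1)])
      fix e assume e: "e\<^sup>\<star> = e" "e * e = p" "\<And>c. c * p = p * c \<Longrightarrow> c * e = e * c"
      have qe: "q * e = e * q" using e(3) qp by simp
      have "(q * e) * (q * e) = (q * e) * (e * q)" by (simp only: qe)
      also have "\<dots> = q * (e * e) * q" by (simp add: mult.assoc)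
      finally have "(q * e) * (q * e) = q * p * q" by (simp add: e(2))
      then show ?thesis
        using norm_pos_square[of "q * e"] by (simp add: star_mult q e(1) qe)
    qed
    then have "x * q = 0" by (intro eq_zero_of_norm_pos_minus) (simp add: star_xq)
    then have "q * p * q = 0" using star_xq by simp
    moreover have "q * q = 2 *\<^sub>R (q * p)"
    proof -
      have "q * q = q * p - q * h" by (subst (2) q_def) (simp add: algebra_simps)
      then show ?thesis by (simp add: qh scaleR_2)
    qed
    ultimately have "(q * q) * q = 0" by simp
    then have "(q * q) * (q * q) = 0" by (simp add: mult.assoc)
    then have "norm (q * q) = 0" using norm_square[of "q * q"] by (simp add: star_mult q)
    then have "q = 0" using norm_square[OF q] by simp
    then show "norm_pos h" using p(1) by (simp add: q_def)
  qed
qed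

theorem cstar_pos_iff_norm_pos: "cstar_pos a \<longleftrightarrow> norm_pos a"
proof
  show "norm_pos a" if "cstar_pos a"
    using that norm_pos_star_mult by (auto simp: cstar_pos_def)
  show "cstar_pos a" if "norm_pos a"
    by (rule norm_pos_sqrt[OF that]) (metis cstar_pos_def)
qed

section \<open>Order and norm inequalities\<close>

lemma norm_pos_conj:
  fixes a x :: "'a::unital_cstar_algebra"
  assumes "norm_pos a" shows "norm_pos (x * a * x\<^sup>\<star>)"
proof (rule norm_pos_sqrt[OF assms])
  fix b assume b: "b\<^sup>\<star> = b" "b * b = a"
  have "norm_pos ((b * x\<^sup>\<star>)\<^sup>\<star> * (b * x\<^sup>\<star>))" by (rule norm_pos_star_mult)
  also have "(b * x\<^sup>\<star>)\<^sup>\<star> * (b * x\<^sup>\<star>) = x * a * x\<^sup>\<star>"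
    by (simp add: star_mult star_star b(1) mult.assoc flip: b(2))
  finally show ?thesis .
qed

lemma norm_pos_mult_star: "norm_pos (x * x\<^sup>\<star>)"
  using norm_pos_star_mult[of "x\<^sup>\<star>"] by (simp add: star_star)

lemma norm_pos_zero [simp]: "norm_pos 0"
  using norm_pos_mult_star[of 0] by simp

lemma norm_pos_of_real: "t \<ge> 0 \<Longrightarrow> norm_pos (of_real t)"
  using norm_pos_scaleR[OF norm_pos_mult_star[of 1], of t] by (simp add: of_real_def)

lemma norm_pos_sum: "(\<And>i. i \<in> S \<Longrightarrow> norm_pos (f i)) \<Longrightarrow> norm_pos (\<Sum>i\<in>S. f i)"
  by (induction S rule: infinite_finite_induct) (auto intro: norm_pos_add)

lemma norm_pos_suminf:
  assumes "summable f" "\<And>n. norm_pos (f n)" shows "norm_pos (\<Sum>n. f n)"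
  by (rule norm_pos_lim[OF summable_LIMSEQ[OF assms(1)]]) (intro norm_pos_sum assms(2))

lemma norm_pos_of_real_minus:
  assumes "a\<^sup>\<star> = a" "norm a \<le> t" shows "norm_pos (of_real t - a)"
  unfolding norm_pos_def using assms by (auto intro!: exI[of _ t])

lemma norm_pos_trans: "norm_pos (b - a) \<Longrightarrow> norm_pos (c - b) \<Longrightarrow> norm_pos (c - a)"
  using norm_pos_add[of "b - a" "c - b"] by simp

text \<open>The chain a \<le> b \<le> \<open>of_real (norm b)\<close> reduces this to a comparison
  with a scalar.\<close>

lemma norm_mono:
  assumes "norm_pos a" "norm_pos (b - a)" shows "norm a \<le> norm b"
proof (rule norm_le_of_norm_pos[OF assms(1)])
  have "norm_pos b" using norm_pos_add[OF assms] by simp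
  then show "norm_pos (of_real (norm b) - a)"
    using norm_pos_trans[OF assms(2) norm_pos_of_real_minus] norm_pos_star by blast
qed simp

text \<open>An abstract Cauchy-Schwarz inequality, shared by Hilbert modules and finite sums: p, q,
  g stand for the products of x with x, y with y, x with y, and the hypothesis is positivity of the
  product of x - r y with itself. The choice r = g / Q with Q slightly above \<open>norm q\<close>
  gives g \<open>g\<^sup>\<star>\<close> / Q \<le> p.\<close>

lemma norm_pos_cauchy_schwarz:
  fixes p q g :: "'a::unital_cstar_algebra"
  assumes q: "norm_pos q"
    and form: "\<And>r. norm_pos (p - r * g\<^sup>\<star> - g * r\<^sup>\<star> + r * q * r\<^sup>\<star>)"
  shows "(norm g)\<^sup>2 \<le> norm p * norm q"
proof (rule field_le_epsilon)
  fix e :: real assume "e > 0"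
  \<comment> \<open>The excess over \<open>norm q\<close> keeps Q positive when q = 0, and its
    denominator makes \<open>norm p\<close> times the excess at most e.\<close>
  define Q where "Q = norm q + e / (norm p + 1)"
  have "e / (norm p + 1) > 0" using \<open>e > 0\<close> by (simp add: add_nonneg_pos)
  then have Q: "Q > 0" "norm q \<le> Q"
    using norm_ge_zero[of q] by (simp_all add: Q_def del: norm_ge_zero)
  let ?G = "g * g\<^sup>\<star>"
  let ?r = "(1 / Q) *\<^sub>R g"
  \<comment> \<open>Adding this term replaces q by the scalar Q in the quadratic part of the
    form.\<close>
  have "norm_pos ((1 / Q)\<^sup>2 *\<^sub>R (g * (of_real Q - q) * g\<^sup>\<star>))"
    by (intro norm_pos_scaleR norm_pos_conj norm_pos_of_real_minus Q norm_pos_star q) simp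
  from norm_pos_add[OF form[of ?r] this]
  have "norm_pos (p - (2 / Q) *\<^sub>R ?G + ((1 / Q)\<^sup>2 * Q) *\<^sub>R ?G)"
    by (simp add: algebra_simps of_real_def power2_eq_square flip: scaleR_add_left)
  also have "p - (2 / Q) *\<^sub>R ?G + ((1 / Q)\<^sup>2 * Q) *\<^sub>R ?G = p - (1 / Q) *\<^sub>R ?G"
  proof -
    have "(1 / Q)\<^sup>2 * Q = 2 / Q - 1 / Q" using Q by (simp add: power2_eq_square)
    then show ?thesis by (simp only: scaleR_diff_left) simp
  qed
  finally have "norm ((1 / Q) *\<^sub>R ?G) \<le> norm p"
    by (intro norm_mono norm_pos_scaleR norm_pos_mult_star) (use Q in auto)
  then have "(norm g)\<^sup>2 \<le> norm p * Q"
    using Q(1) by (simp add: norm_mult_star field_simps)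
  also have "\<dots> = norm p * norm q + norm p / (norm p + 1) * e"
    by (simp add: Q_def algebra_simps)
  also have "\<dots> \<le> norm p * norm q + e"
  proof (intro add_left_mono)
    have "norm p / (norm p + 1) \<le> 1" by (rule divide_le_eq_1_pos[THEN iffD2]) (simp_all add: add_nonneg_pos)
    then show "norm p / (norm p + 1) * e \<le> e"
      using \<open>e > 0\<close> mult_right_mono[of "norm p / (norm p + 1)" 1 e] by simp
  qed
  finally show "(norm g)\<^sup>2 \<le> norm p * norm q + e" .
qed

section \<open>Inverses and inverse square roots\<close>

lemma one_minus_invertible:
  fixes x :: "'a::unital_cstar_algebra"
  assumes "norm x < 1" obtains y where "y * (1 - x) = 1" "(1 - x) * y = 1"
proof
  have s: "summable (\<lambda>n. x ^ n)" by (rule complete_algebra_summable_geometric[OF assms])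
  have "(\<Sum>n. x ^ n) = 1 + (\<Sum>n. x ^ Suc n)"
    using suminf_split_head[OF s] by simp
  moreover have "(\<Sum>n. x ^ Suc n) = x * (\<Sum>n. x ^ n)" "(\<Sum>n. x ^ Suc n) = (\<Sum>n. x ^ n) * x"
    using suminf_mult[OF s, of x] suminf_mult2[OF s, of x] by (simp_all add: power_commutes)
  ultimately show "(\<Sum>n. x ^ n) * (1 - x) = 1" "(1 - x) * (\<Sum>n. x ^ n) = 1"
    by (simp_all add: algebra_simps)
qed

text \<open>Divided by \<open>norm p + e\<close>, the element \<open>p + of_real e\<close> lies at
  distance less than 1 from 1, so the Neumann series inverts it. With i the inverse and k the square
  root, the inverse of k is \<open>i * k\<close>.\<close>

lemma norm_pos_inverse_sqrt:
  fixes p :: "'a::unital_cstar_algebra"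
  assumes p: "norm_pos p" and e: "e > 0"
  obtains h k where "h\<^sup>\<star> = h" "k\<^sup>\<star> = k" "h * k = 1" "k * h = 1" "k * k = p + of_real e"
proof -
  let ?g = "p + of_real e"
  define s where "s = norm p + e"
  have s: "s > 0" using e norm_ge_zero[of p] by (simp add: s_def del: norm_ge_zero)
  have "1 - (1 / s) *\<^sub>R ?g = (1 / s) *\<^sub>R (of_real (norm p) - p)"
  proof -
    have "(1 / s) *\<^sub>R (?g + (of_real (norm p) - p)) = 1"
      using s by (simp add: of_real_def s_def flip: scaleR_add_left) (simp add: add.commute)
    then show ?thesis by (simp add: scaleR_add_right algebra_simps)
  qed
  then have "norm (1 - (1 / s) *\<^sub>R ?g) \<le> norm p / s"
    using norm_pos_bound[OF p order_refl] s by (simp add: divide_right_mono)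
  also have "\<dots> < 1" using s e by (simp add: s_def)
  finally obtain y where y: "y * (1 - (1 - (1 / s) *\<^sub>R ?g)) = 1" "(1 - (1 - (1 / s) *\<^sub>R ?g)) * y = 1"
    by (rule one_minus_invertible)
  define i where "i = (1 / s) *\<^sub>R y"
  have i: "i * ?g = 1" "?g * i = 1" using y by (simp_all add: i_def)
  have "norm_pos ?g" by (intro norm_pos_add p norm_pos_of_real) (use e in simp)
  then show ?thesis
  proof (rule norm_pos_sqrt)
    fix k assume k: "k\<^sup>\<star> = k" "k * k = ?g"
    have hk: "(i * k) * k = 1" using i(1) k(2) by (simp add: mult.assoc)
    have "k * i = (i * ?g) * (k * i)" by (simp add: i)
    also have "\<dots> = i * k * (?g * i)" by (simp add: k(2)[symmetric] mult.assoc)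
    finally have "k * i = i * k" by (simp add: i)
    then have kh: "k * (i * k) = 1" using hk by (metis mult.assoc)
    \<comment> \<open>The adjoint of a right inverse of the self-adjoint k is a left inverse, so the
      two coincide and h is self-adjoint.\<close>
    have "(i * k)\<^sup>\<star> * k = 1" using arg_cong[OF kh, of star] by (simp add: star_mult k(1) mult.assoc)
    then have "(i * k)\<^sup>\<star> = i * k" using kh by (metis mult.assoc mult_1_left mult_1_right)
    then show ?thesis using that k hk kh by blast
  qed
qed

section \<open>The uniform boundedness principle\<close>

text \<open>By Baire's theorem one of the closed sets \<open>S k\<close>, which cover the space,
  contains a ball. The difference of two of its points then bounds every \<open>f i\<close> on
  vectors of length r by 2 k.\<close>

lemma uniform_boundedness:
  fixes f :: "'i \<Rightarrow> 'e::banach \<Rightarrow> 'b::real_normed_vector"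
  assumes lin: "\<And>i. i \<in> I \<Longrightarrow> bounded_linear (f i)"
    and pointwise: "\<And>x. \<exists>M. \<forall>i\<in>I. norm (f i x) \<le> M"
  obtains K where "K \<ge> 0" "\<And>i x. i \<in> I \<Longrightarrow> norm (f i x) \<le> K * norm x"
proof -
  define S where "S k = {x. \<forall>i\<in>I. norm (f i x) \<le> real k}" for k :: nat
  have closed: "closed (S k)" for k
  proof -
    have "S k = (\<Inter>i\<in>I. {x. norm (f i x) \<le> real k})" by (auto simp: S_def)
    moreover have "closed {x. norm (f i x) \<le> real k}" if "i \<in> I" for i
      using lin[OF that] by (intro closed_Collect_le continuous_intros linear_continuous_on)
    ultimately show ?thesis by auto
  qed
  have cover: "\<Union> (range S) = UNIV"
  proof -
    have "\<exists>k. x \<in> S k" for x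
    proof -
      obtain M where M: "\<forall>i\<in>I. norm (f i x) \<le> M" using pointwise by blast
      obtain k where "M \<le> real k" using real_arch_simple by blast
      then have "x \<in> S k" using M by (auto simp: S_def intro: order_trans)
      then show ?thesis ..
    qed
    then show ?thesis by auto
  qed
  have "\<exists>k. interior (S k) \<noteq> {}"
  proof (rule ccontr)
    assume none: "\<not> (\<exists>k. interior (S k) \<noteq> {})"
    have "(euclidean :: 'e topology) interior_of \<Union> (range S) = {}"
    proof (rule Baire_category_alt)
      show "completely_metrizable_space (euclidean :: 'e topology) \<or>
          locally_compact_space (euclidean :: 'e topology) \<and> regular_space (euclidean :: 'e topology)"
        using completely_metrizable_space_euclidean by blast
      show "closedin euclidean T \<and> euclidean interior_of T = {}" if "T \<in> range S" for T
        using that closed none by auto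
    qed simp
    then show False by (simp add: cover)
  qed
  then obtain k x0 r where r: "r > 0" "cball x0 r \<subseteq> S k"
    by (meson ex_in_conv mem_interior_cball)
  show ?thesis
  proof (rule that)
    show "2 * real k / r \<ge> 0" using r by simp
    fix i x assume i: "i \<in> I"
    interpret bounded_linear "f i" by (rule lin[OF i])
    show "norm (f i x) \<le> 2 * real k / r * norm x"
    proof (cases "x = 0")
      case False
      let ?z = "(r / norm x) *\<^sub>R x"
      have "x0 + ?z \<in> S k" "x0 \<in> S k"
        using r False by (auto simp: subset_eq dist_norm)
      then have "norm (f i (x0 + ?z)) \<le> k" "norm (f i x0) \<le> k" using i by (auto simp: S_def)
      then have "norm (f i (x0 + ?z) - f i x0) \<le> 2 * real k"
        using norm_triangle_ineq4[of "f i (x0 + ?z)" "f i x0"] by linarith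
      then have "r / norm x * norm (f i x) \<le> 2 * real k"
        using r by (simp add: add scaleR)
      then show ?thesis using r False by (simp add: field_simps)
    qed (simp add: zero)
  qed
qed

section \<open>Hilbert modules\<close>

context hilbert_module
begin

lemma ip_add_right: "ip x (y + z) = ip x y + ip x z"
  by (metis ip_add_left ip_star star_add)

lemma ip_act_right: "ip x (a \<cdot> y) = ip x y * a\<^sup>\<star>"
  by (metis ip_act_left ip_star star_mult)

lemma ip_scaleR_left: "ip (r *\<^sub>R x) y = r *\<^sub>R ip x y"
  using ip_act_left[of "of_real r" x y] by (simp add: act_of_real scaleR_conv_of_real)

lemma norm_pos_ip: "norm_pos (ip x x)"
  using ip_pos by (simp add: cstar_pos_iff_norm_pos)

lemma norm_ip_self: "norm (ip x x) = (norm x)\<^sup>2"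
  by (simp add: norm_eq)

lemma ip_uminus_left: "ip (- x) y = - ip x y"
  using ip_add_left[of x "- x" y] ip_add_left[of 0 0 y] by (simp add: add_eq_0_iff)

lemma ip_uminus_right: "ip x (- y) = - ip x y"
  using ip_add_right[of x y "- y"] ip_add_right[of x 0 0] by (simp add: add_eq_0_iff)

lemma norm_ip_le: "norm (ip x y) \<le> norm x * norm y"
proof -
  have "(norm (ip x y))\<^sup>2 \<le> norm (ip x x) * norm (ip y y)"
  proof (rule norm_pos_cauchy_schwarz[OF norm_pos_ip])
    fix r
    have "ip (x + - (r \<cdot> y)) (x + - (r \<cdot> y))
      = ip x x - r * (ip x y)\<^sup>\<star> - ip x y * r\<^sup>\<star> + r * ip y y * r\<^sup>\<star>"
      by (simp only: ip_add_left ip_add_right ip_uminus_left ip_uminus_right ip_act_left ip_act_right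
          ip_star minus_mult_left[symmetric]) (simp add: algebra_simps)
    then show "norm_pos (ip x x - r * (ip x y)\<^sup>\<star> - ip x y * r\<^sup>\<star> + r * ip y y * r\<^sup>\<star>)"
      using norm_pos_ip by metis
  qed
  also have "\<dots> = (norm x * norm y)\<^sup>2" by (simp add: norm_ip_self power_mult_distrib)
  finally show ?thesis by (rule power2_le_imp_le) simp
qed

lemma bounded_linear_ip_left: "bounded_linear (\<lambda>x. ip x y)"
  by (rule bounded_linear_intro[where K = "norm y"]) (simp_all add: ip_add_left ip_scaleR_left norm_ip_le)

text \<open>Paschke's trick: apply the norm bound to the vectors \<open>h \<cdot> y\<close>, where
  \<open>h\<close> is the inverse square root of \<open>ip y y + of_real e\<close>, and let \<open>e\<close> tend to \<open>0\<close>.\<close>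

lemma quadratic_le_of_norm_le:
  assumes pos: "\<And>y. norm_pos (f y)" and act: "\<And>a y. f (a \<cdot> y) = a * f y * a\<^sup>\<star>"
    and bound: "\<And>y. norm (f y) \<le> K * (norm y)\<^sup>2" and K: "K \<ge> 0"
  shows "norm_pos (K *\<^sub>R ip y y - f y)"
proof (rule norm_pos_lim)
  have "(\<lambda>n. K *\<^sub>R (ip y y + of_real (inverse (real (Suc n)))) - f y)
    \<longlonglongrightarrow> K *\<^sub>R (ip y y + of_real 0) - f y"
    by (intro tendsto_intros LIMSEQ_inverse_real_of_nat)
  then show "(\<lambda>n. K *\<^sub>R (ip y y + of_real (inverse (real (Suc n)))) - f y)
    \<longlonglongrightarrow> K *\<^sub>R ip y y - f y" by simp
  fix n
  define e where "e = inverse (real (Suc n))"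
  have "e > 0" by (simp add: e_def)
  then show "norm_pos (K *\<^sub>R (ip y y + of_real (inverse (real (Suc n)))) - f y)"
  proof (rule norm_pos_inverse_sqrt[OF norm_pos_ip])
    fix h k assume hk: "h\<^sup>\<star> = h" "k\<^sup>\<star> = k" "h * k = 1" "k * h = 1" "k * k = ip y y + of_real e"
    define z where "z = h \<cdot> y"
    have y: "y = k \<cdot> z" by (simp add: z_def act_act hk(4) act_one)
    \<comment> \<open>The product equals 1 - e \<open>h * h\<close>, so z lies in the unit ball
      independently of y.\<close>
    have "ip z z = h * (k * k - of_real e) * h"
      by (simp add: z_def ip_act_left ip_act_right hk(1) hk(5) mult.assoc)
    also have "\<dots> = (h * k) * (k * h) - e *\<^sub>R (h * h)"
      by (simp add: algebra_simps of_real_def)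
    finally have "of_real 1 - ip z z = e *\<^sub>R (h * h\<^sup>\<star>)" by (simp add: hk)
    then have "norm_pos (of_real 1 - ip z z)"
      using norm_pos_scaleR[OF norm_pos_mult_star[of h], of e] \<open>e > 0\<close> by simp
    then have "norm (ip z z) \<le> 1" by (rule norm_le_of_norm_pos[OF norm_pos_ip]) simp
    then have z: "(norm z)\<^sup>2 \<le> 1" by (simp add: norm_ip_self)
    have "norm (f z) \<le> K"
      using bound[of z] mult_left_mono[OF z K] by simp
    \<comment> \<open>Conjugation by k undoes the normalization, since y = k \<cdot> z and
      \<open>f\<close> is quadratic.\<close>
    then have "norm_pos (k * (of_real K - f z) * k\<^sup>\<star>)"
      by (intro norm_pos_conj norm_pos_of_real_minus norm_pos_star pos)
    also have "k * (of_real K - f z) * k\<^sup>\<star> = K *\<^sub>R (k * k) - k * f z * k\<^sup>\<star>"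
      by (simp add: algebra_simps of_real_def hk(2))
    also have "\<dots> = K *\<^sub>R (ip y y + of_real e) - f y"
      by (subst (2) y) (simp add: hk(5) act)
    finally show ?thesis unfolding e_def .
  qed
qed

end

section \<open>The module of square-summable sequences\<close>

lemma norm_sum_mult_star_le:
  fixes a b :: "nat \<Rightarrow> 'a::unital_cstar_algebra"
  shows "(norm (\<Sum>n\<in>S. a n * (b n)\<^sup>\<star>))\<^sup>2
    \<le> norm (\<Sum>n\<in>S. a n * (a n)\<^sup>\<star>) * norm (\<Sum>n\<in>S. b n * (b n)\<^sup>\<star>)"
proof (rule norm_pos_cauchy_schwarz)
  show "norm_pos (\<Sum>n\<in>S. b n * (b n)\<^sup>\<star>)" by (intro norm_pos_sum norm_pos_mult_star)
  fix r
  have "norm_pos (\<Sum>n\<in>S. (a n - r * b n) * (a n - r * b n)\<^sup>\<star>)"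
    by (intro norm_pos_sum norm_pos_mult_star)
  also have "(\<Sum>n\<in>S. (a n - r * b n) * (a n - r * b n)\<^sup>\<star>)
    = (\<Sum>n\<in>S. a n * (a n)\<^sup>\<star>) - r * (\<Sum>n\<in>S. a n * (b n)\<^sup>\<star>)\<^sup>\<star> - (\<Sum>n\<in>S. a n * (b n)\<^sup>\<star>) * r\<^sup>\<star>
      + r * (\<Sum>n\<in>S. b n * (b n)\<^sup>\<star>) * r\<^sup>\<star>"
    by (simp add: star_sum star_mult star_star sum_distrib_left sum_distrib_right
        algebra_simps sum.distrib sum_subtractf)
  finally show "norm_pos \<dots>" .
qed

text \<open>Cauchy-Schwarz on a block of indices bounds the mixed sum by the two diagonal ones,
  which are small far out.\<close>

lemma summable_l2_ip:
  fixes a b :: "nat \<Rightarrow> 'a::unital_cstar_algebra"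
  assumes "a \<in> l2" "b \<in> l2" shows "summable (\<lambda>n. a n * (b n)\<^sup>\<star>)"
  unfolding summable_Cauchy
proof (intro allI impI)
  fix e :: real assume "e > 0"
  have "summable (\<lambda>n. a n * (a n)\<^sup>\<star>)" "summable (\<lambda>n. b n * (b n)\<^sup>\<star>)"
    using assms by (auto simp: l2_def)
  then obtain M N where
    M: "\<And>m n. m \<ge> M \<Longrightarrow> norm (\<Sum>n=m..<n. a n * (a n)\<^sup>\<star>) < e" and
    N: "\<And>m n. m \<ge> N \<Longrightarrow> norm (\<Sum>n=m..<n. b n * (b n)\<^sup>\<star>) < e"
    unfolding summable_Cauchy using \<open>e > 0\<close> by meson
  show "\<exists>N. \<forall>m\<ge>N. \<forall>n. norm (\<Sum>n=m..<n. a n * (b n)\<^sup>\<star>) < e"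
  proof (intro exI allI impI)
    fix m n assume m: "m \<ge> max M N"
    have "(norm (\<Sum>n=m..<n. a n * (b n)\<^sup>\<star>))\<^sup>2
      \<le> norm (\<Sum>n=m..<n. a n * (a n)\<^sup>\<star>) * norm (\<Sum>n=m..<n. b n * (b n)\<^sup>\<star>)"
      by (rule norm_sum_mult_star_le)
    also have "\<dots> < e * e" using M[of m n] N[of m n] m by (intro mult_strict_mono') auto
    finally have "(norm (\<Sum>n=m..<n. a n * (b n)\<^sup>\<star>))\<^sup>2 < e\<^sup>2" by (simp add: power2_eq_square)
    then show "norm (\<Sum>n=m..<n. a n * (b n)\<^sup>\<star>) < e"
      by (rule power2_less_imp_less) (use \<open>e > 0\<close> in simp)
  qed
qed

lemma l2_ip_add_left:
  assumes "a \<in> l2" "b \<in> l2" "c \<in> l2"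
  shows "l2_ip (\<lambda>n. a n + b n) c = l2_ip a c + l2_ip b c"
  using suminf_add[OF summable_l2_ip[OF assms(1,3)] summable_l2_ip[OF assms(2,3)]]
  by (simp add: l2_ip_def distrib_right)

lemma l2_ip_mult_left:
  assumes "a \<in> l2" "b \<in> l2" shows "l2_ip (\<lambda>n. r * a n) b = r * l2_ip a b"
  using suminf_mult[OF summable_l2_ip[OF assms], of r] by (simp add: l2_ip_def mult.assoc)

lemma l2_ip_star:
  assumes "a \<in> l2" "b \<in> l2" shows "(l2_ip a b)\<^sup>\<star> = l2_ip b a"
  using star_suminf[OF summable_l2_ip[OF assms]] by (simp add: l2_ip_def star_mult star_star)

lemma norm_pos_l2_ip: "a \<in> l2 \<Longrightarrow> norm_pos (l2_ip a a)"
  unfolding l2_ip_def by (intro norm_pos_suminf summable_l2_ip norm_pos_mult_star)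

lemma norm_l2_ip_le:
  assumes "a \<in> l2" "b \<in> l2"
  shows "(norm (l2_ip a b))\<^sup>2 \<le> norm (l2_ip a a) * norm (l2_ip b b)"
proof (rule LIMSEQ_le)
  show "(\<lambda>N. (norm (\<Sum>n<N. a n * (b n)\<^sup>\<star>))\<^sup>2) \<longlonglongrightarrow> (norm (l2_ip a b))\<^sup>2"
    unfolding l2_ip_def by (intro tendsto_intros summable_LIMSEQ summable_l2_ip assms)
  show "(\<lambda>N. norm (\<Sum>n<N. a n * (a n)\<^sup>\<star>) * norm (\<Sum>n<N. b n * (b n)\<^sup>\<star>))
      \<longlonglongrightarrow> norm (l2_ip a a) * norm (l2_ip b b)"
    unfolding l2_ip_def by (intro tendsto_intros summable_LIMSEQ summable_l2_ip assms)
qed (use norm_sum_mult_star_le in blast)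

lemma l2_scale: "a \<in> l2 \<Longrightarrow> (\<lambda>n. r *\<^sub>R a n) \<in> l2"
  by (simp add: l2_def summable_scaleR_right)

text \<open>Uniform boundedness replaces the completeness of \<open>l2\<close>, on which an adjointable operator
  would be bounded by the closed graph theorem.\<close>

lemma l2_valued_bounded:
  fixes R :: "'e::banach \<Rightarrow> nat \<Rightarrow> 'a::unital_cstar_algebra"
  assumes l2: "\<And>x. R x \<in> l2"
    and weak: "\<And>b. b \<in> l2 \<Longrightarrow> bounded_linear (\<lambda>x. l2_ip (R x) b)"
  obtains K where "K \<ge> 0" "\<And>x. norm (l2_ip (R x) (R x)) \<le> K * (norm x)\<^sup>2"
proof -
  let ?I = "{b \<in> l2 :: (nat \<Rightarrow> 'a) set. norm (l2_ip b b) \<le> 1}"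
  show ?thesis
  proof (rule uniform_boundedness[where I = ?I and f = "\<lambda>b x. l2_ip (R x) b"])
    show "bounded_linear (\<lambda>x. l2_ip (R x) b)" if "b \<in> ?I" for b
      using that weak by simp
    show "\<exists>M. \<forall>b\<in>?I. norm (l2_ip (R x) b) \<le> M" for x
    proof (intro exI ballI)
      fix b assume b: "b \<in> ?I"
      have "(norm (l2_ip (R x) b))\<^sup>2 \<le> norm (l2_ip (R x) (R x)) * norm (l2_ip b b)"
        using b by (intro norm_l2_ip_le l2) simp
      also have "\<dots> \<le> norm (l2_ip (R x) (R x))"
        using b by (simp add: mult_left_le)
      finally show "norm (l2_ip (R x) b) \<le> sqrt (norm (l2_ip (R x) (R x)))"
        by (rule real_le_rsqrt)
    qed
  next
    fix K :: real assume K: "K \<ge> 0" "\<And>b x. b \<in> ?I \<Longrightarrow> norm (l2_ip (R x) b) \<le> K * norm x"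
    show ?thesis
    proof (rule that)
      fix x
      define s where "s = sqrt (norm (l2_ip (R x) (R x)))"
      have ss: "norm (l2_ip (R x) (R x)) = s * s" by (simp add: s_def)
      show "norm (l2_ip (R x) (R x)) \<le> K\<^sup>2 * (norm x)\<^sup>2"
      proof (cases "s = 0")
        case False
        then have s: "s > 0" by (simp add: s_def)
        \<comment> \<open>This unit vector pairs with \<open>R x\<close> to an element of norm
          exactly s, so the uniform weak bound becomes a norm bound.\<close>
        let ?b = "\<lambda>n. (1 / s) *\<^sub>R R x n"
        have b: "?b \<in> l2" by (intro l2_scale l2)
        have xb: "l2_ip (R x) ?b = (1 / s) *\<^sub>R l2_ip (R x) (R x)"
          unfolding l2_ip_def by (simp add: suminf_scaleR_right summable_l2_ip l2)
        have "l2_ip ?b ?b = (1 / s * (1 / s)) *\<^sub>R l2_ip (R x) (R x)"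
          unfolding l2_ip_def
          by (subst suminf_scaleR_right) (simp_all add: summable_l2_ip l2)
        then have "?b \<in> ?I" using s b by (simp add: ss)
        from K(2)[OF this, of x] have "s \<le> K * norm x" using s by (simp add: xb ss)
        then have "s\<^sup>2 \<le> (K * norm x)\<^sup>2" using s by (intro power_mono) simp_all
        then show ?thesis by (simp add: ss power2_eq_square power_mult_distrib algebra_simps)
      qed (simp add: ss)
    qed simp
  qed
qed

section \<open>Comparison with a series\<close>

lemma positive_functional_add: "positive_functional \<phi> \<Longrightarrow> \<phi> (a + b) = \<phi> a + \<phi> b"
  by (simp add: positive_functional_def)

lemma positive_functional_scaleR: "positive_functional \<phi> \<Longrightarrow> \<phi> (r *\<^sub>R a) = of_real r * \<phi> a"
  by (metis positive_functional_def scaleC_of_real)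

lemma positive_functional_diff: "positive_functional \<phi> \<Longrightarrow> \<phi> (a - b) = \<phi> a - \<phi> b"
  using positive_functional_add[of \<phi> "a - b" b] by simp

lemma positive_functional_zero: "positive_functional \<phi> \<Longrightarrow> \<phi> 0 = 0"
  using positive_functional_diff[of \<phi> 0 0] by simp

lemma positive_functional_sum: "positive_functional \<phi> \<Longrightarrow> \<phi> (\<Sum>i\<in>S. f i) = (\<Sum>i\<in>S. \<phi> (f i))"
  by (induction S rule: infinite_finite_induct)
    (simp_all add: positive_functional_zero positive_functional_add)

lemma positive_functional_nonneg:
  assumes "positive_functional \<phi>" "norm_pos a" shows "0 \<le> Re (\<phi> a)"
proof -
  obtain b where "a = b\<^sup>\<star> * b"
    using assms(2) by (auto simp: cstar_pos_def simp flip: cstar_pos_iff_norm_pos)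
  then show ?thesis using assms(1) by (auto simp: positive_functional_def complex_nonneg_Reals_iff)
qed

text \<open>Positivity applied to \<open>of_real (norm a) - a\<close>. This takes the place of
  continuity, which \<open>positive_functional\<close> does not postulate.\<close>

lemma positive_functional_le_norm:
  assumes \<phi>: "positive_functional \<phi>" and a: "a\<^sup>\<star> = a"
  shows "Re (\<phi> a) \<le> norm a * Re (\<phi> 1)"
  using positive_functional_nonneg[OF \<phi> norm_pos_of_real_minus[OF a order_refl]]
  by (simp add: positive_functional_diff[OF \<phi>] positive_functional_scaleR[OF \<phi>] of_real_def)

text \<open>The inequality behind both cases of \<open>le_series\<close> is that of the partial sums in
  \<open>0 \<le> (\<Sum>n<N. (c n - K *\<^sub>R b n) * (c n - K *\<^sub>R b n)\<^sup>\<star>)\<close>.\<close>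

lemma le_series_of_factorization:
  fixes b c :: "nat \<Rightarrow> 'a::unital_cstar_algebra"
  assumes c: "c \<in> l2" and K: "K > 0" and cp: "norm_pos (K *\<^sub>R p - l2_ip c c)"
    and sums: "(\<lambda>n. c n * (b n)\<^sup>\<star>) sums p"
  shows "le_series ((1 / K) *\<^sub>R p) (\<lambda>n. b n * (b n)\<^sup>\<star>)"
proof -
  define q where "q N = (\<Sum>n<N. c n * (b n)\<^sup>\<star>)" for N
  define B where "B N = (\<Sum>n<N. b n * (b n)\<^sup>\<star>)" for N
  have q: "q \<longlonglongrightarrow> p" using sums unfolding q_def sums_def .
  have p: "p\<^sup>\<star> = p"
  proof -
    have "norm_pos ((1 / K) *\<^sub>R ((K *\<^sub>R p - l2_ip c c) + l2_ip c c))"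
      by (intro norm_pos_scaleR norm_pos_add cp norm_pos_l2_ip c) (use K in simp)
    then show ?thesis using K by (simp add: norm_pos_star)
  qed
  have q_star: "(\<lambda>N. (q N)\<^sup>\<star>) \<longlonglongrightarrow> p" using tendsto_star[OF q] by (simp add: p)
  have partial: "norm_pos (B N - (1 / K) *\<^sub>R (q N + (q N)\<^sup>\<star> - p))" for N
  proof -
    let ?C = "\<Sum>n<N. c n * (c n)\<^sup>\<star>"
    have s: "summable (\<lambda>n. c n * (c n)\<^sup>\<star>)" by (rule summable_l2_ip[OF c c])
    \<comment> \<open>The tail is positive, so the partial sum \<open>?C\<close> lies below
      \<open>l2_ip c c\<close> and hence below \<open>K *\<^sub>R p\<close>.\<close>
    have "norm_pos (\<Sum>n. c (n + N) * (c (n + N))\<^sup>\<star>)"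
      by (rule norm_pos_suminf[OF summable_ignore_initial_segment[OF s] norm_pos_mult_star])
    then have "norm_pos (l2_ip c c - ?C)"
      by (simp add: l2_ip_def suminf_minus_initial_segment[OF s])
    then have 1: "norm_pos (K *\<^sub>R p - ?C)" by (rule norm_pos_trans[OF _ cp])
    let ?D = "\<Sum>n<N. (c n - K *\<^sub>R b n) * (c n - K *\<^sub>R b n)\<^sup>\<star>"
    have 2: "norm_pos ?D" by (intro norm_pos_sum norm_pos_mult_star)
    have D: "?D = ?C - K *\<^sub>R (q N + (q N)\<^sup>\<star>) + (K * K) *\<^sub>R B N"
      by (simp add: q_def B_def star_sum star_mult star_star algebra_simps sum.distrib
          sum_subtractf scaleR_sum_right)
    \<comment> \<open>The added term cancels \<open>?C\<close>, so only sums that involve b and the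
      limit p remain.\<close>
    have "norm_pos ((1 / (K * K)) *\<^sub>R (?D + (K *\<^sub>R p - ?C)))"
      by (intro norm_pos_scaleR norm_pos_add 1 2) (use K in simp)
    also have "(1 / (K * K)) *\<^sub>R (?D + (K *\<^sub>R p - ?C)) = B N - (1 / K) *\<^sub>R (q N + (q N)\<^sup>\<star> - p)"
      unfolding D using K by (simp add: algebra_simps)
    finally show ?thesis .
  qed
  show ?thesis
  proof (cases "summable (\<lambda>n. b n * (b n)\<^sup>\<star>)")
    case True
    then have "B \<longlonglongrightarrow> (\<Sum>n. b n * (b n)\<^sup>\<star>)" unfolding B_def by (rule summable_LIMSEQ)
    then have "(\<lambda>N. B N - (1 / K) *\<^sub>R (q N + (q N)\<^sup>\<star> - p))
        \<longlonglongrightarrow> (\<Sum>n. b n * (b n)\<^sup>\<star>) - (1 / K) *\<^sub>R (p + p - p)"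
      by (intro tendsto_intros q q_star)
    from norm_pos_lim[OF this partial] show ?thesis
      using True by (simp add: le_series_def cstar_le_def cstar_pos_iff_norm_pos)
  next
    case False
    have "ennreal (Re (\<phi> ((1 / K) *\<^sub>R p))) \<le> (\<Sum>n. ennreal (Re (\<phi> (b n * (b n)\<^sup>\<star>))))"
      if \<phi>: "positive_functional \<phi>" for \<phi>
    proof (rule LIMSEQ_le_const2)
      \<comment> \<open>The sums q N + \<open>(q N)\<^sup>\<star>\<close> tend to 2 p;
        \<open>?e N\<close> is the norm error, and it changes the value of \<phi> by at most
        \<open>?e N * Re (\<phi> 1)\<close>.\<close>
      let ?e = "\<lambda>N. norm (p + p - (q N + (q N)\<^sup>\<star>))"
      have "(\<lambda>N. ennreal ((1 / K) * (Re (\<phi> p) - ?e N * Re (\<phi> 1))))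
          \<longlonglongrightarrow> ennreal ((1 / K) * (Re (\<phi> p) - norm (p + p - (p + p)) * Re (\<phi> 1)))"
        by (intro tendsto_ennrealI tendsto_intros q q_star)
      then show "(\<lambda>N. ennreal ((1 / K) * (Re (\<phi> p) - ?e N * Re (\<phi> 1))))
          \<longlonglongrightarrow> ennreal (Re (\<phi> ((1 / K) *\<^sub>R p)))"
        by (simp add: positive_functional_scaleR[OF \<phi>])
      have "ennreal ((1 / K) * (Re (\<phi> p) - ?e N * Re (\<phi> 1))) \<le> (\<Sum>n. ennreal (Re (\<phi> (b n * (b n)\<^sup>\<star>))))" for N
      proof -
        have "Re (\<phi> (p + p - (q N + (q N)\<^sup>\<star>))) \<le> ?e N * Re (\<phi> 1)"
          by (intro positive_functional_le_norm \<phi>) (simp add: star_add star_star p add.commute)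
        then have "Re (\<phi> p) - ?e N * Re (\<phi> 1) \<le> Re (\<phi> (q N + (q N)\<^sup>\<star> - p))"
          by (simp add: positive_functional_add[OF \<phi>] positive_functional_diff[OF \<phi>])
        then have "(1 / K) * (Re (\<phi> p) - ?e N * Re (\<phi> 1)) \<le> (1 / K) * Re (\<phi> (q N + (q N)\<^sup>\<star> - p))"
          using K by (intro mult_left_mono) simp_all
        also have "\<dots> \<le> Re (\<phi> (B N))"
          using positive_functional_nonneg[OF \<phi> partial[of N]]
          by (simp add: positive_functional_diff[OF \<phi>, of "B N"] positive_functional_scaleR[OF \<phi>])
        also have "\<dots> = (\<Sum>n<N. Re (\<phi> (b n * (b n)\<^sup>\<star>)))"
          by (simp add: B_def positive_functional_sum[OF \<phi>])
        finally have "ennreal ((1 / K) * (Re (\<phi> p) - ?e N * Re (\<phi> 1)))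
            \<le> ennreal (\<Sum>n<N. Re (\<phi> (b n * (b n)\<^sup>\<star>)))"
          by (rule ennreal_leI)
        also have "\<dots> = (\<Sum>n<N. ennreal (Re (\<phi> (b n * (b n)\<^sup>\<star>))))"
          by (intro sum_ennreal[symmetric] positive_functional_nonneg[OF \<phi>] norm_pos_mult_star)
        also have "\<dots> \<le> (\<Sum>n. ennreal (Re (\<phi> (b n * (b n)\<^sup>\<star>))))"
          by (intro sum_le_suminf) auto
        finally show ?thesis .
      qed
      then show "\<exists>N. \<forall>n\<ge>N. ennreal ((1 / K) * (Re (\<phi> p) - ?e n * Re (\<phi> 1)))
          \<le> (\<Sum>n. ennreal (Re (\<phi> (b n * (b n)\<^sup>\<star>))))" by blast
    qed
    then show ?thesis using False by (simp add: le_series_def)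
  qed
qed

section \<open>Bessel sequences and multipliers\<close>

context hilbert_module
begin

lemma analysis_op_in_l2: "standard_bessel ip X D \<Longrightarrow> analysis_op ip X x \<in> l2"
  by (simp add: standard_bessel_def l2_def analysis_op_def ip_star)

lemma norm_analysis_op_le:
  assumes X: "standard_bessel ip X D"
  shows "norm (l2_ip (analysis_op ip X x) (analysis_op ip X x)) \<le> D * (norm x)\<^sup>2"
proof -
  have D: "D > 0" and "norm_pos (D *\<^sub>R ip x x - l2_ip (analysis_op ip X x) (analysis_op ip X x))"
    using X by (simp_all add: standard_bessel_def cstar_le_def cstar_pos_iff_norm_pos l2_ip_def
        analysis_op_def ip_star)
  from norm_mono[OF norm_pos_l2_ip[OF analysis_op_in_l2[OF X]] this(2)]
  show ?thesis using D by (simp add: norm_ip_self)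
qed

lemma l2_ip_analysis_op_act:
  assumes "standard_bessel ip X D" "b \<in> l2"
  shows "l2_ip (analysis_op ip X (a \<cdot> x)) b = a * l2_ip (analysis_op ip X x) b"
  using l2_ip_mult_left[OF analysis_op_in_l2[OF assms(1)] assms(2)]
  by (simp add: analysis_op_def ip_act_left)

lemma bounded_linear_l2_ip_analysis_op:
  assumes X: "standard_bessel ip X D" and b: "b \<in> l2"
  shows "bounded_linear (\<lambda>x. l2_ip (analysis_op ip X x) b)"
proof (rule bounded_linear_intro)
  fix x y r
  show "l2_ip (analysis_op ip X (x + y)) b = l2_ip (analysis_op ip X x) b + l2_ip (analysis_op ip X y) b"
    using l2_ip_add_left[OF analysis_op_in_l2[OF X] analysis_op_in_l2[OF X] b]
    by (simp add: analysis_op_def ip_add_left)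
  show "l2_ip (analysis_op ip X (r *\<^sub>R x)) b = r *\<^sub>R l2_ip (analysis_op ip X x) b"
    using l2_ip_analysis_op_act[OF assms, of "of_real r" x]
    by (simp add: act_of_real scaleR_conv_of_real)
  have D: "D \<ge> 0" using X by (simp add: standard_bessel_def)
  have "(norm (l2_ip (analysis_op ip X x) b))\<^sup>2 \<le> D * (norm x)\<^sup>2 * norm (l2_ip b b)"
    using norm_l2_ip_le[OF analysis_op_in_l2[OF X] b] norm_analysis_op_le[OF X]
    by (meson mult_right_mono norm_ge_zero order_trans)
  also have "\<dots> = (norm x * sqrt (D * norm (l2_ip b b)))\<^sup>2"
    using D by (simp add: power_mult_distrib)
  finally show "norm (l2_ip (analysis_op ip X x) b) \<le> norm x * sqrt (D * norm (l2_ip b b))"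
    by (rule power2_le_imp_le) (use D in simp)
qed

end

theorem proposition3p4:
  fixes actE :: "'a::unital_cstar_algebra \<Rightarrow> 'e::banach \<Rightarrow> 'e" and ipE :: "'e \<Rightarrow> 'e \<Rightarrow> 'a"
    and actF :: "'a \<Rightarrow> 'f::banach \<Rightarrow> 'f" and ipF :: "'f \<Rightarrow> 'f \<Rightarrow> 'a"
    and X :: "nat \<Rightarrow> 'e" and Y :: "nat \<Rightarrow> 'f" and D :: real
    and U :: "(nat \<Rightarrow> 'a) \<Rightarrow> (nat \<Rightarrow> 'a)"
  assumes "hilbert_module actE ipE" and "hilbert_module actF ipF"
    and "finitely_generated actE \<or> countably_generated actE"
    and "finitely_generated actF \<or> countably_generated actF"
    and "standard_bessel ipE X D"
    and "l2_adjointable U" and "\<exists>a\<in>l2. U a \<noteq> (\<lambda>_. 0)"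
    and "\<forall>x. summable (multiplier_term ipE actF U Y X x)"
    and "invertible_operator actE actF (multiplier ipE actF U Y X)"
  shows "lower_frame_condition ipF Y"
proof -
  interpret E: hilbert_module actE ipE by (rule assms(1))
  interpret F: hilbert_module actF ipF by (rule assms(2))
  note X = assms(5)
  obtain V where U_l2: "\<And>a. a \<in> l2 \<Longrightarrow> U a \<in> l2" and V_l2: "\<And>b. b \<in> l2 \<Longrightarrow> V b \<in> l2"
    and adj: "\<And>a b. a \<in> l2 \<Longrightarrow> b \<in> l2 \<Longrightarrow> l2_ip (U a) b = l2_ip a (V b)"
    using assms(6) unfolding l2_adjointable_def by blast
  obtain S where S: "bounded_linear S" "\<And>a y. S (actF a y) = actE a (S y)"
    and MS: "\<And>y. multiplier ipE actF U Y X (S y) = y"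
    using assms(9) unfolding invertible_operator_def bounded_module_map_def by blast
  \<comment> \<open>The coefficient sequence c: summing the \<open>actF (R y n) (Y n)\<close>
    returns y because S is a right inverse of the multiplier.\<close>
  define R where "R y = U (analysis_op ipE X (S y))" for y
  have R_l2: "R y \<in> l2" for y
    unfolding R_def by (intro U_l2 E.analysis_op_in_l2[OF X])
  have R_ip: "l2_ip (R y) b = l2_ip (analysis_op ipE X (S y)) (V b)" if "b \<in> l2" for y b
    unfolding R_def by (rule adj[OF E.analysis_op_in_l2[OF X] that])
  \<comment> \<open>Moving U to its adjoint V leaves a pairing of the analysis operator with the
    fixed sequence \<open>V b\<close>, which is bounded.\<close>
  have "bounded_linear (\<lambda>y. l2_ip (R y) b)" if b: "b \<in> l2" for b
    using bounded_linear_compose[OF E.bounded_linear_l2_ip_analysis_op[OF X V_l2[OF b]] S(1)]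
    by (simp add: R_ip[OF b])
  then obtain K where K: "K \<ge> 0" "\<And>y. norm (l2_ip (R y) (R y)) \<le> K * (norm y)\<^sup>2"
    using l2_valued_bounded[of R] R_l2 by blast
  have R_act: "l2_ip (R (actF a y)) b = a * l2_ip (R y) b" if b: "b \<in> l2" for a y b
    by (simp add: R_ip[OF b] S(2) E.l2_ip_analysis_op_act[OF X V_l2[OF b]])
  \<comment> \<open>The scalar leaves the first argument by \<open>R_act\<close>; the star exchanges
    the arguments, so it leaves the second one in the same way.\<close>
  have "l2_ip (R (actF a y)) (R (actF a y)) = a * l2_ip (R y) (R y) * a\<^sup>\<star>" for a y
    using l2_ip_star[OF R_l2 R_l2, of "actF a y" y] l2_ip_star[OF R_l2 R_l2, of y y]
    by (simp add: R_act[OF R_l2] star_mult mult.assoc)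
  then have quad: "norm_pos (K *\<^sub>R ipF y y - l2_ip (R y) (R y))" for y
    by (intro F.quadratic_le_of_norm_le norm_pos_l2_ip R_l2 K)
  \<comment> \<open>K may be 0; enlarging it by 1 makes the frame constant 1 / (K + 1) positive and
    finite.\<close>
  have "norm_pos ((K + 1) *\<^sub>R ipF y y - l2_ip (R y) (R y))" for y
    using norm_pos_add[OF quad[of y] F.norm_pos_ip[of y]] by (simp add: algebra_simps)
  moreover have "(\<lambda>n. R y n * (ipF y (Y n))\<^sup>\<star>) sums ipF y y" for y
  proof -
    \<comment> \<open>The convergent reconstruction series, to be paired with y term by
      term.\<close>
    have "(\<lambda>n. actF (R y n) (Y n)) sums y"
      using assms(8)[rule_format, of "S y", THEN summable_sums] MS[of y]
      by (simp add: multiplier_def multiplier_term_def R_def)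
    from bounded_linear.sums[OF F.bounded_linear_ip_left this, of y] show ?thesis
      by (simp add: F.ip_act_left F.ip_star)
  qed
  ultimately have "le_series ((1 / (K + 1)) *\<^sub>R ipF y y) (\<lambda>n. ipF y (Y n) * (ipF y (Y n))\<^sup>\<star>)" for y
    using K(1) by (intro le_series_of_factorization[OF R_l2]) simp_all
  then have "le_series ((1 / (K + 1)) *\<^sub>R ipF y y) (\<lambda>n. ipF y (Y n) * ipF (Y n) y)" for y
    by (simp add: F.ip_star)
  moreover have "1 / (K + 1) > 0" using K(1) by simp
  ultimately show ?thesis
    unfolding lower_frame_condition_def by blast
qed

end
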